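(* Let $M$ be a monad on $\mathbf{Set}$ and $(\mathcal{A},\cdot)$ a monadic applicative structure over $M$. Then $\mathcal{A}$ admits the structure of a monadic combinatory algebra over $M$ if and only if $\mathcal{A}$, with application morphism $\circledast:=\cdot$, is a combinatory object in the Freyd category $\langle\mathbf{Set},\mathbf{Set}_M,J_M\rangle$, i.e. if and only if every positive $\mathcal{A}$-monomial is $\mathcal{A}$-computable.
   Context: $(M,\eta,\mu)$ is a monad on $\mathbf{Set}$; write $\mathrm{let}\ x\Leftarrow m\ \mathrm{in}\ g(x):=\mu(Mg(m))$. An MAS over $M$ is a set $\mathcal{A}$ with a map $\cdot:\mathcal{A}\times\mathcal{A}\to M\mathcal{A}$. MCA: expressions $e::= i\in\mathbb{N}\mid c\in\mathcal{A}\mid e\bullet e$, $E_n(\mathcal{A})$ those with all variables $<n$; substitution $0[c]=c$, $(i+1)[c]=i$, $c'[c]=c'$, $(e_1\bullet e_2)[c]=e_1[c]\bullet e_2[c]$; evaluation $\nu(c)=\eta(c)$, $\nu(e_f\bullet e_a)=\mathrm{let}\ c_f\Leftarrow\nu(e_f)\ \mathrm{in}\ \mathrm{let}\ c_a\Leftarrow\nu(e_a)\ \mathrm{in}\ c_f\cdot c_a$; an MCA is an MAS with codes $\langle\lambda^n.e\rangle\in\mathcal{A}$ ($e\in E_{n+1}(\mathcal{A})$) with $\langle\lambda^{n+1}.e\rangle\cdot c=\eta(\langle\lambda^n.e[c]\rangle)$ and $\langle\lambda^0.e\rangle\cdot c=\nu(e[c])$. The Freyd category $\langle\mathbf{Set},\mathbf{Set}_M,J_M\rangle$: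 $\mathbf{Set}_M$ is the Kleisli category (morphisms $A\to B$ are functions $A\to MB$), $J_M(f)=\eta\circ f$, and the premonoidal actions are $(f\ltimes B)(x,y)=\mathrm{let}\ x'\Leftarrow f(x)\ \mathrm{in}\ \eta(x',y)$, $(A\rtimes f)(x,y)=\mathrm{let}\ y'\Leftarrow f(y)\ \mathrm{in}\ \eta(x,y')$, structural isomorphisms being those of $\mathbf{Set}$ composed with $\eta$. Concretely, global elements $1\to\mathcal{A}$ in $\mathbf{Set}$ are elements of $\mathcal{A}$. Iterated application: for $a\in\mathcal{A}$ and $x_1,\dots,x_m\in\mathcal{A}$, $\circledast^0(a)=\eta(a)$ and $\circledast^{m+1}(a,x_1,\dots,x_{m+1})=\mathrm{let}\ b\Leftarrow a\cdot x_1\ \mathrm{in}\ \circledast^m(b,x_2,\dots,x_{m+1})$. $\mathcal{A}$-computable: for $n>0$, a Kleisli map $f:\mathcal{A}^n\to M\mathcal{A}$ is $\mathcal{A}$-computable if for every $k\in\{0,\dots,n-1\}$ and all $c_1,\dots,c_k\in\mathcal{A}$ there is a code $\ulcorner f(c_1,\dots,c_k)\urcorner\in\mathcal{A}$ (written $\ulcorner f\urcorner$ when $k=0$) such that for all $x_{k+1},\dots,x_n\in\mathcal{A}$, $\circledast^{n-k}(\ulcorner f(c_1,\dots,c_k)\urcorner,x_{k+1},\dots,x_n)=f(c_1,\dots,c_k,x_{k+1},\dots,x_n)$, and $\circledast^k(\ulcorner f\urcorner,c_1,\dots,c_k)=\eta(\ulcorner f(c_1,\dots,c_k)\urcorner)$.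 $\mathcal{A}$-monomials: for $p::= i\in\mathbb{N}\mid c\in\mathcal{A}\mid p\bullet p$ with all variables $<n$, define $[\![p]\!]_n:\mathcal{A}^n\to M\mathcal{A}$ by $[\![i]\!]_n(\vec x)=\eta(x_{i+1})$, $[\![c]\!]_n(\vec x)=\eta(c)$, $[\![p_f\bullet p_a]\!]_n(\vec x)=\mathrm{let}\ f\Leftarrow[\![p_f]\!]_n(\vec x)\ \mathrm{in}\ \mathrm{let}\ a\Leftarrow[\![p_a]\!]_n(\vec x)\ \mathrm{in}\ f\cdot a$. A positive $\mathcal{A}$-monomial is a map of the form $[\![p]\!]_n$ with $n>0$. A combinatory object is an applicative object all of whose positive monomials are $\mathcal{A}$-computable. *)

theory Defs
  imports "HOL-Library.FuncSet" "HOL-Library.NList"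
begin

text \<open>
  Monads on the category of sets. HOL cannot quantify over type constructors, so the category of
  sets is the full category on a family \<open>\<U>\<close> of sets over an arbitrary type \<open>'u\<close> (for instance, the
  sets of a universe): its morphisms from \<open>A\<close> to \<open>B\<close> are the elements of \<open>A \<rightarrow>\<^sub>E B\<close>, its composition
  is \<^const>\<open>compose\<close>. No closure property of \<open>\<U>\<close> is assumed beyond closure under the functor.
\<close>

record 'u monad_data =
  MObj :: "'u set \<Rightarrow> 'u set"
  MMap :: "'u set \<Rightarrow> 'u set \<Rightarrow> ('u \<Rightarrow> 'u) \<Rightarrow> ('u \<Rightarrow> 'u)"
  eta :: "'u set \<Rightarrow> 'u \<Rightarrow> 'u"
  mu :: "'u set \<Rightarrow> 'u \<Rightarrow> 'u"

locale set_monad =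
  fixes \<U> :: "'u set set" and T :: "'u monad_data"
  assumes MObj_closed: "A \<in> \<U> \<Longrightarrow> MObj T A \<in> \<U>"
    and MMap_hom: "\<lbrakk>A \<in> \<U>; B \<in> \<U>; f \<in> A \<rightarrow>\<^sub>E B\<rbrakk> \<Longrightarrow> MMap T A B f \<in> MObj T A \<rightarrow>\<^sub>E MObj T B"
    and MMap_id: "A \<in> \<U> \<Longrightarrow> MMap T A A (\<lambda>x\<in>A. x) = (\<lambda>m\<in>MObj T A. m)"
    and MMap_comp: "\<lbrakk>A \<in> \<U>; B \<in> \<U>; C \<in> \<U>; f \<in> A \<rightarrow>\<^sub>E B; g \<in> B \<rightarrow>\<^sub>E C\<rbrakk> \<Longrightarrow>
      MMap T A C (compose A g f) = compose (MObj T A) (MMap T B C g) (MMap T A B f)"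
    and eta_hom: "A \<in> \<U> \<Longrightarrow> eta T A \<in> A \<rightarrow>\<^sub>E MObj T A"
    and eta_natural: "\<lbrakk>A \<in> \<U>; B \<in> \<U>; f \<in> A \<rightarrow>\<^sub>E B\<rbrakk> \<Longrightarrow>
      compose A (eta T B) f = compose A (MMap T A B f) (eta T A)"
    and mu_hom: "A \<in> \<U> \<Longrightarrow> mu T A \<in> MObj T (MObj T A) \<rightarrow>\<^sub>E MObj T A"
    and mu_natural: "\<lbrakk>A \<in> \<U>; B \<in> \<U>; f \<in> A \<rightarrow>\<^sub>E B\<rbrakk> \<Longrightarrow>
      compose (MObj T (MObj T A)) (mu T B) (MMap T (MObj T A) (MObj T B) (MMap T A B f)) =
      compose (MObj T (MObj T A)) (MMap T A B f) (mu T A)"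
    and mu_eta: "A \<in> \<U> \<Longrightarrow>
      compose (MObj T A) (mu T A) (eta T (MObj T A)) = (\<lambda>m\<in>MObj T A. m)"
    and mu_MMap_eta: "A \<in> \<U> \<Longrightarrow>
      compose (MObj T A) (mu T A) (MMap T A (MObj T A) (eta T A)) = (\<lambda>m\<in>MObj T A. m)"
    and mu_assoc: "A \<in> \<U> \<Longrightarrow>
      compose (MObj T (MObj T (MObj T A))) (mu T A) (mu T (MObj T A)) =
      compose (MObj T (MObj T (MObj T A))) (mu T A) (MMap T (MObj T (MObj T A)) (MObj T A) (mu T A))"

text \<open>\<open>mlet T A B m g\<close> is \<open>let x \<Leftarrow> m in g x\<close>, for \<open>m \<in> M A\<close> and \<open>g : A \<rightarrow> M B\<close>.\<close>

definition mlet :: "'u monad_data \<Rightarrow> 'u set \<Rightarrow> 'u set \<Rightarrow> 'u \<Rightarrow> ('u \<Rightarrow> 'u) \<Rightarrow> 'u" where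
  "mlet T A B m g = mu T B (MMap T A (MObj T B) (restrict g A) m)"

locale mas = set_monad \<U> T for \<U> :: "'u set set" and T :: "'u monad_data" +
  fixes A :: "'u set" and app :: "'u \<Rightarrow> 'u \<Rightarrow> 'u"
  assumes carrier_obj: "A \<in> \<U>"
    and app_closed: "\<lbrakk>a \<in> A; b \<in> A\<rbrakk> \<Longrightarrow> app a b \<in> MObj T A"

datatype (codes: 'c) expr = Var nat | Code 'c | App "'c expr" "'c expr"

primrec vars :: "'c expr \<Rightarrow> nat set" where
  "vars (Var i) = {i}"
| "vars (Code c) = {}"
| "vars (App f a) = vars f \<union> vars a"

definition exprs :: "nat \<Rightarrow> 'c set \<Rightarrow> 'c expr set" where
  "exprs n A = {e. vars e \<subseteq> {..<n} \<and> codes e \<subseteq> A}"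

primrec subst :: "'c expr \<Rightarrow> 'c \<Rightarrow> 'c expr" where
  "subst (Var i) c = (case i of 0 \<Rightarrow> Code c | Suc j \<Rightarrow> Var j)"
| "subst (Code c') c = Code c'"
| "subst (App f a) c = App (subst f c) (subst a c)"

text \<open>Evaluation is meant for closed expressions only.\<close>

primrec eval_expr :: "'u monad_data \<Rightarrow> 'u set \<Rightarrow> ('u \<Rightarrow> 'u \<Rightarrow> 'u) \<Rightarrow> 'u expr \<Rightarrow> 'u" where
  "eval_expr T A app (Var i) = undefined"
| "eval_expr T A app (Code c) = eta T A c"
| "eval_expr T A app (App ef ea) =
    mlet T A A (eval_expr T A app ef) (\<lambda>cf. mlet T A A (eval_expr T A app ea) (\<lambda>ca. app cf ca))"

text \<open>\<open>lam n e\<close> is the code \<open>\<langle>\<lambda>\<^sup>n.e\<rangle>\<close>, which takes \<open>n + 1\<close> arguments.\<close>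

locale mca = mas \<U> T A app
  for \<U> :: "'u set set" and T :: "'u monad_data" and A :: "'u set" and app :: "'u \<Rightarrow> 'u \<Rightarrow> 'u" +
  fixes lam :: "nat \<Rightarrow> 'u expr \<Rightarrow> 'u"
  assumes lam_closed: "e \<in> exprs (Suc n) A \<Longrightarrow> lam n e \<in> A"
    and lam_Suc: "\<lbrakk>e \<in> exprs (Suc (Suc n)) A; c \<in> A\<rbrakk> \<Longrightarrow>
      app (lam (Suc n) e) c = eta T A (lam n (subst e c))"
    and lam_0: "\<lbrakk>e \<in> exprs (Suc 0) A; c \<in> A\<rbrakk> \<Longrightarrow>
      app (lam 0 e) c = eval_expr T A app (subst e c)"

text \<open>The power \<open>A\<^sup>n\<close> is represented by \<^term>\<open>nlists n A\<close>, the lists of length \<open>n\<close> over \<open>A\<close>.\<close>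

primrec iter_app ::
  "'u monad_data \<Rightarrow> 'u set \<Rightarrow> ('u \<Rightarrow> 'u \<Rightarrow> 'u) \<Rightarrow> 'u \<Rightarrow> 'u list \<Rightarrow> 'u" where
  "iter_app T A app a [] = eta T A a"
| "iter_app T A app a (x # xs) = mlet T A A (app a x) (\<lambda>b. iter_app T A app b xs)"

text \<open>\<open>code [c\<^sub>1, \<dots>, c\<^sub>k]\<close> is the code of \<open>f(c\<^sub>1, \<dots>, c\<^sub>k)\<close>, so \<open>code []\<close> is the code of \<open>f\<close>.\<close>

definition computable ::
  "'u monad_data \<Rightarrow> 'u set \<Rightarrow> ('u \<Rightarrow> 'u \<Rightarrow> 'u) \<Rightarrow> nat \<Rightarrow> ('u list \<Rightarrow> 'u) \<Rightarrow> bool" where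
  "computable T A app n f \<longleftrightarrow>
    (\<exists>code. \<forall>k<n. \<forall>cs\<in>nlists k A.
      code cs \<in> A \<and>
      (\<forall>xs\<in>nlists (n - k) A. iter_app T A app (code cs) xs = f (cs @ xs)) \<and>
      iter_app T A app (code []) cs = eta T A (code cs))"

primrec interp ::
  "'u monad_data \<Rightarrow> 'u set \<Rightarrow> ('u \<Rightarrow> 'u \<Rightarrow> 'u) \<Rightarrow> 'u expr \<Rightarrow> 'u list \<Rightarrow> 'u" where
  "interp T A app (Var i) xs = eta T A (xs ! i)"
| "interp T A app (Code c) xs = eta T A c"
| "interp T A app (App pf pa) xs =
    mlet T A A (interp T A app pf xs) (\<lambda>f. mlet T A A (interp T A app pa xs) (\<lambda>a. app f a))"

definition monomial ::
  "'u monad_data \<Rightarrow> 'u set \<Rightarrow> ('u \<Rightarrow> 'u \<Rightarrow> 'u) \<Rightarrow> nat \<Rightarrow> ('u list \<Rightarrow> 'u) \<Rightarrow> bool" where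
  "monomial T A app n f \<longleftrightarrow> (\<exists>p\<in>exprs n A. f = (\<lambda>xs\<in>nlists n A. interp T A app p xs))"

text \<open>
  Combinatory objects of the Freyd category of \<open>T\<close>: an applicative object there is a set with a
  Kleisli map from its square to itself, that is, an MAS.
\<close>

locale combinatory_object = mas \<U> T A app
  for \<U> :: "'u set set" and T :: "'u monad_data" and A :: "'u set" and app :: "'u \<Rightarrow> 'u \<Rightarrow> 'u" +
  assumes monomials_computable: "\<lbrakk>n > 0; monomial T A app n f\<rbrakk> \<Longrightarrow> computable T A app n f"

end

theory Submission imports Defs begin

text \<open>
  In an MCA, the code of \<open>\<lbrakk>p\<rbrakk>\<^sub>n(c\<^sub>1, \<dots>, c\<^sub>k)\<close> is \<open>\<langle>\<lambda>\<^sup>n\<^sup>-\<^sup>1\<^sup>-\<^sup>k. p[c\<^sub>1]\<dots>[c\<^sub>k]\<rangle>\<close>.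

  Conversely, the codes that computability provides for the monomials of two expressions \<open>e\<close>, \<open>e'\<close>
  need not agree when \<open>e[c] = e'[c']\<close>, so they cannot serve as \<open>\<langle>\<lambda>\<^sup>n.e\<rangle>\<close> directly. As in bracket
  abstraction, \<open>\<langle>\<lambda>\<^sup>n.e\<rangle>\<close> is instead built by recursion on \<open>e\<close> from combinators indexed by \<open>n\<close>:
  \<open>\<langle>\<lambda>\<^sup>n.c\<rangle>\<close> is \<open>K\<^sub>n(c)\<close> and \<open>\<langle>\<lambda>\<^sup>n.e\<^sub>1 \<bullet> e\<^sub>2\<rangle>\<close> is \<open>S\<^sub>n(\<langle>\<lambda>\<^sup>n.e\<^sub>1\<rangle>, \<langle>\<lambda>\<^sup>n.e\<^sub>2\<rangle>)\<close>, where \<open>K\<^sub>n\<close> and \<open>S\<^sub>n\<close> realize the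
  monomials \<open>K\<^sub>0(a, x) = a\<close>, \<open>K\<^sub>n\<^sub>+\<^sub>1(a, x) = K\<^sub>n \<bullet> a\<close>, \<open>S\<^sub>0(u, v, x) = (u \<bullet> x) \<bullet> (v \<bullet> x)\<close> and
  \<open>S\<^sub>n\<^sub>+\<^sub>1(u, v, x) = (S\<^sub>n \<bullet> (u \<bullet> x)) \<bullet> (v \<bullet> x)\<close>. The index makes application to one argument perform
  exactly one substitution.
\<close>

declare nlistsE_length [simp del] nlistsE_set [simp del] \<comment> \<open>they loop together with \<open>nlists_def\<close>\<close>

section \<open>Unit laws and congruence for Kleisli binding\<close>

context set_monad
begin

lemma eta_closed: "\<lbrakk>X \<in> \<U>; x \<in> X\<rbrakk> \<Longrightarrow> eta T X x \<in> MObj T X"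
  using eta_hom by blast

lemma mlet_closed:
  assumes "X \<in> \<U>" "Y \<in> \<U>" "m \<in> MObj T X" "\<And>x. x \<in> X \<Longrightarrow> g x \<in> MObj T Y"
  shows "mlet T X Y m g \<in> MObj T Y"
proof -
  have "restrict g X \<in> X \<rightarrow>\<^sub>E MObj T Y"
    using assms(4) by simp
  then have "MMap T X (MObj T Y) (restrict g X) \<in> MObj T X \<rightarrow>\<^sub>E MObj T (MObj T Y)"
    using MMap_hom assms(1,2) MObj_closed by blast
  then show ?thesis
    using mu_hom[OF assms(2)] assms(3) unfolding mlet_def by blast
qed

lemma mlet_cong: "(\<And>x. x \<in> X \<Longrightarrow> g x = h x) \<Longrightarrow> mlet T X Y m g = mlet T X Y m h"
  unfolding mlet_def by (metis restrict_ext)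

lemma mlet_eta_left:
  assumes "X \<in> \<U>" "Y \<in> \<U>" "x \<in> X" "\<And>x. x \<in> X \<Longrightarrow> g x \<in> MObj T Y"
  shows "mlet T X Y (eta T X x) g = g x"
proof -
  have "restrict g X \<in> X \<rightarrow>\<^sub>E MObj T Y"
    using assms(4) by simp
  from eta_natural[OF assms(1) MObj_closed[OF assms(2)] this]
  have "eta T (MObj T Y) (g x) = MMap T X (MObj T Y) (restrict g X) (eta T X x)"
    using assms(3) by (auto simp: compose_def dest: fun_cong[where x = x])
  moreover have "mu T Y (eta T (MObj T Y) (g x)) = g x"
    using fun_cong[OF mu_eta[OF assms(2)], of "g x"] assms(3,4) by (simp add: compose_def)
  ultimately show ?thesis
    unfolding mlet_def by simp
qed

lemma mlet_eta_right:
  assumes "X \<in> \<U>" "m \<in> MObj T X"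
  shows "mlet T X X m (eta T X) = m"
proof -
  have "restrict (eta T X) X = eta T X"
    using eta_hom[OF assms(1)] by (simp add: PiE_def extensional_restrict)
  then show ?thesis
    using fun_cong[OF mu_MMap_eta[OF assms(1)], of m] assms(2)
    unfolding mlet_def by (simp add: compose_def)
qed

end

section \<open>Substitution against interpretation of expressions\<close>

lemma Var_in_exprs [simp]: "Var i \<in> exprs n X \<longleftrightarrow> i < n"
  by (auto simp: exprs_def)

lemma Code_in_exprs [simp]: "Code c \<in> exprs n X \<longleftrightarrow> c \<in> X"
  by (auto simp: exprs_def)

lemma App_in_exprs [simp]: "App f a \<in> exprs n X \<longleftrightarrow> f \<in> exprs n X \<and> a \<in> exprs n X"
  by (auto simp: exprs_def)

lemma subst_in_exprs: "\<lbrakk>e \<in> exprs (Suc n) X; c \<in> X\<rbrakk> \<Longrightarrow> subst e c \<in> exprs n X"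
  by (induction e) (auto split: nat.split)

lemma foldl_subst_in_exprs:
  "\<lbrakk>e \<in> exprs (length cs + n) X; set cs \<subseteq> X\<rbrakk> \<Longrightarrow> foldl subst e cs \<in> exprs n X"
  by (induction cs arbitrary: e) (auto intro: subst_in_exprs)

text \<open>\<open>Var 0\<close> reads the head of the list and \<open>Var (Suc j)\<close> its tail,
  matching the renumbering done by \<open>subst\<close>.\<close>

lemma interp_subst: "interp T X ap (subst e c) xs = interp T X ap e (c # xs)"
  by (induction e) (auto split: nat.split)

lemma interp_foldl_subst: "interp T X ap (foldl subst e cs) xs = interp T X ap e (cs @ xs)"
  by (induction cs arbitrary: e) (auto simp: interp_subst)

lemma eval_expr_eq_interp: "e \<in> exprs 0 X \<Longrightarrow> eval_expr T X ap e = interp T X ap e []"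
  by (induction e) auto

context mas
begin

lemma iter_app_closed: "\<lbrakk>a \<in> A; set xs \<subseteq> A\<rbrakk> \<Longrightarrow> iter_app T A app a xs \<in> MObj T A"
  by (induction xs arbitrary: a) (auto intro!: mlet_closed eta_closed carrier_obj app_closed)

lemma iter_app_single: "\<lbrakk>a \<in> A; x \<in> A\<rbrakk> \<Longrightarrow> iter_app T A app a [x] = app a x"
  by (simp add: mlet_eta_right carrier_obj app_closed)

lemma iter_app_Cons_eta:
  "\<lbrakk>app a x = eta T A b; b \<in> A; set xs \<subseteq> A\<rbrakk> \<Longrightarrow>
    iter_app T A app a (x # xs) = iter_app T A app b xs"
  by (simp add: mlet_eta_left carrier_obj iter_app_closed)

lemma mlet_eta_left': "\<lbrakk>x \<in> A; \<And>x. x \<in> A \<Longrightarrow> g x \<in> MObj T A\<rbrakk> \<Longrightarrow> mlet T A A (eta T A x) g = g x"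
  by (simp add: mlet_eta_left carrier_obj)

end

section \<open>From an MCA to a combinatory object\<close>

context mca
begin

text \<open>Each argument in \<open>cs\<close> leaves an abstraction pending, so only
  \<open>lam_Suc\<close> fires and nothing is evaluated.\<close>

lemma iter_app_lam_partial:
  "\<lbrakk>e \<in> exprs (length cs + Suc n) A; set cs \<subseteq> A\<rbrakk> \<Longrightarrow>
    iter_app T A app (lam (length cs + n) e) cs = eta T A (lam n (foldl subst e cs))"
proof (induction cs arbitrary: e)
  case (Cons c cs)
  have e: "subst e c \<in> exprs (length cs + Suc n) A"
    using Cons.prems by (auto intro: subst_in_exprs)
  have "iter_app T A app (lam (length (c # cs) + n) e) (c # cs) =
      iter_app T A app (lam (length cs + n) (subst e c)) cs"
    using Cons.prems e by (intro iter_app_Cons_eta) (auto intro: lam_Suc lam_closed)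
  also have "\<dots> = eta T A (lam n (foldl subst e (c # cs)))"
    using Cons.IH[OF e] Cons.prems by simp
  finally show ?case .
qed simp

lemma iter_app_lam_total:
  "\<lbrakk>e \<in> exprs (Suc n) A; length xs = Suc n; set xs \<subseteq> A\<rbrakk> \<Longrightarrow>
    iter_app T A app (lam n e) xs = interp T A app e xs"
proof (induction xs arbitrary: e n)
  case (Cons x xs)
  have e: "subst e x \<in> exprs n A"
    using Cons.prems by (auto intro: subst_in_exprs)
  show ?case
  proof (cases n)
    case 0
    then have "app (lam n e) x = interp T A app e [x]"
      using Cons.prems e by (simp add: lam_0 eval_expr_eq_interp interp_subst)
    then show ?thesis
      using 0 Cons.prems iter_app_single[of "lam n e" x] by (simp add: lam_closed)
  next
    case (Suc m)
    have "iter_app T A app (lam n e) (x # xs) = iter_app T A app (lam m (subst e x)) xs"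
      using Cons.prems e Suc by (intro iter_app_Cons_eta) (auto intro: lam_Suc lam_closed)
    then show ?thesis
      using Cons.IH[of "subst e x" m] Cons.prems e Suc by (simp add: interp_subst)
  qed
qed simp

lemma combinatory_object: "combinatory_object \<U> T A app"
proof unfold_locales
  fix n f
  assume "0 < n" and "monomial T A app n f"
  then obtain p where p: "p \<in> exprs n A" and f: "f = (\<lambda>xs\<in>nlists n A. interp T A app p xs)"
    unfolding monomial_def by blast
  \<comment> \<open>\<open>lam m\<close> takes \<open>m + 1\<close> arguments, and
    \<open>n - length cs\<close> are still due.\<close>
  define code where "code cs = lam (n - Suc (length cs)) (foldl subst p cs)" for cs
  have "code cs \<in> A \<and>
      (\<forall>xs\<in>nlists (n - k) A. iter_app T A app (code cs) xs = f (cs @ xs)) \<and>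
      iter_app T A app (code []) cs = eta T A (code cs)"
    if "k < n" "cs \<in> nlists k A" for k cs
  proof -
    from that have cs: "length cs = k" "set cs \<subseteq> A"
      by (auto simp: nlists_def)
    obtain m where n: "n = length cs + Suc m"
      using less_imp_Suc_add[OF \<open>k < n\<close>] cs by auto
    have e: "foldl subst p cs \<in> exprs (Suc m) A"
      using foldl_subst_in_exprs p cs n by blast
    have "iter_app T A app (code cs) xs = f (cs @ xs)" if "xs \<in> nlists (n - k) A" for xs
      using that iter_app_lam_total[OF e, of xs] cs n
      by (simp add: code_def f nlists_def interp_foldl_subst)
    moreover have "iter_app T A app (code []) cs = eta T A (code cs)"
      using iter_app_lam_partial[of p cs m] p cs n by (simp add: code_def)
    moreover have "code cs \<in> A"
      using e n by (simp add: code_def lam_closed)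
    ultimately show ?thesis
      by blast
  qed
  then show "computable T A app n f"
    unfolding computable_def by (intro exI[of _ code]) simp
qed

end

section \<open>Bracket abstraction in a combinatory object\<close>

context combinatory_object
begin

definition realizer :: "nat \<Rightarrow> 'u expr \<Rightarrow> 'u list \<Rightarrow> 'u" where
  "realizer n p = (SOME code. \<forall>k<n. \<forall>cs\<in>nlists k A.
      code cs \<in> A \<and>
      (\<forall>xs\<in>nlists (n - k) A. iter_app T A app (code cs) xs = interp T A app p (cs @ xs)) \<and>
      iter_app T A app (code []) cs = eta T A (code cs))"

lemma realizer:
  assumes "p \<in> exprs n A" "length cs < n" "set cs \<subseteq> A"
  shows realizer_closed: "realizer n p cs \<in> A"
    and iter_app_realizer_partial:
      "iter_app T A app (realizer n p []) cs = eta T A (realizer n p cs)"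
    and iter_app_realizer: "\<And>xs. \<lbrakk>length cs + length xs = n; set xs \<subseteq> A\<rbrakk> \<Longrightarrow>
      iter_app T A app (realizer n p cs) xs = interp T A app p (cs @ xs)"
proof -
  let ?f = "\<lambda>xs\<in>nlists n A. interp T A app p xs"
  have "computable T A app n ?f"
    using assms by (intro monomials_computable) (auto simp: monomial_def)
  then obtain code where code: "\<forall>k<n. \<forall>cs\<in>nlists k A.
      code cs \<in> A \<and>
      (\<forall>xs\<in>nlists (n - k) A. iter_app T A app (code cs) xs = ?f (cs @ xs)) \<and>
      iter_app T A app (code []) cs = eta T A (code cs)"
    unfolding computable_def by blast
  \<comment> \<open>The restriction in \<open>?f\<close> vanishes, since all concatenated lists have
    length \<open>n\<close>.\<close>
  have "\<exists>code. \<forall>k<n. \<forall>cs\<in>nlists k A.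
      code cs \<in> A \<and>
      (\<forall>xs\<in>nlists (n - k) A. iter_app T A app (code cs) xs = interp T A app p (cs @ xs)) \<and>
      iter_app T A app (code []) cs = eta T A (code cs)"
    using code by (intro exI[of _ code]) (simp add: nlists_def)
  from someI_ex[OF this, folded realizer_def] assms
  show "realizer n p cs \<in> A"
    and "iter_app T A app (realizer n p []) cs = eta T A (realizer n p cs)"
    and "\<And>xs. \<lbrakk>length cs + length xs = n; set xs \<subseteq> A\<rbrakk> \<Longrightarrow>
      iter_app T A app (realizer n p cs) xs = interp T A app p (cs @ xs)"
    by (auto simp: nlists_def)
qed

lemma app_realizer:
  assumes "p \<in> exprs (Suc (length cs)) A" "set cs \<subseteq> A" "x \<in> A"
  shows "app (realizer (Suc (length cs)) p cs) x = interp T A app p (cs @ [x])"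
  using iter_app_realizer[OF assms(1) _ assms(2), of "[x]"] iter_app_single[OF realizer_closed] assms
  by simp

text \<open>The list holds the arguments already supplied: \<open>K n []\<close> is the combinator,
  \<open>K n [a]\<close> the code of its partial application. \<open>S\<close> follows the same
  convention.\<close>

primrec K :: "nat \<Rightarrow> 'u list \<Rightarrow> 'u" where
  "K 0 = realizer 2 (Var 0)"
| "K (Suc n) = realizer 2 (App (Code (K n [])) (Var 0))"

primrec S :: "nat \<Rightarrow> 'u list \<Rightarrow> 'u" where
  "S 0 = realizer 3 (App (App (Var 0) (Var 2)) (App (Var 1) (Var 2)))"
| "S (Suc n) = realizer 3
    (App (App (Code (S n [])) (App (Var 0) (Var 2))) (App (Var 1) (Var 2)))"

text \<open>The code of variable \<open>i\<close> under \<open>n + 1\<close> abstractions. Variable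
  0 turns the argument into a constant; any other drops it and is renumbered. \<open>proj 0\<close>
  ignores \<open>i\<close>, as only variable 0 is legal there.\<close>

primrec proj :: "nat \<Rightarrow> nat \<Rightarrow> 'u" where
  "proj 0 i = realizer 1 (Var 0) []"
| "proj (Suc n) i = (case i of
    0 \<Rightarrow> realizer 1 (App (Code (K n [])) (Var 0)) []
  | Suc j \<Rightarrow> realizer 1 (Code (proj n j)) [])"

primrec lambda :: "nat \<Rightarrow> 'u expr \<Rightarrow> 'u" where
  "lambda n (Var i) = proj n i"
| "lambda n (Code c) = K n [c]"
| "lambda n (App e1 e2) = S n [lambda n e1, lambda n e2]"

lemma K_closed: "\<lbrakk>length cs < 2; set cs \<subseteq> A\<rbrakk> \<Longrightarrow> K n cs \<in> A"
  by (induction n arbitrary: cs) (auto intro!: realizer_closed)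

lemma S_closed: "\<lbrakk>length cs < 3; set cs \<subseteq> A\<rbrakk> \<Longrightarrow> S n cs \<in> A"
  by (induction n arbitrary: cs) (auto intro!: realizer_closed)

lemma proj_closed: "proj n i \<in> A"
  by (induction n arbitrary: i) (auto intro!: realizer_closed K_closed split: nat.split)

text \<open>\<open>m\<close> need not match \<open>n\<close>: \<open>proj\<close> is total in
  \<open>A\<close>, so only the codes in \<open>e\<close> matter.\<close>

lemma lambda_closed: "e \<in> exprs m A \<Longrightarrow> lambda n e \<in> A"
  by (induction e) (auto intro!: proj_closed K_closed S_closed)

lemma app_K_Nil: "c \<in> A \<Longrightarrow> app (K n []) c = eta T A (K n [c])"
proof -
  assume c: "c \<in> A"
  have "iter_app T A app (K n []) [c] = eta T A (K n [c])"
    using c by (cases n) (auto intro!: iter_app_realizer_partial K_closed simp del: iter_app.simps)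
  then show ?thesis
    using iter_app_single[of "K n []" c] c by (simp add: K_closed)
qed

lemma app_K_0: "\<lbrakk>a \<in> A; c \<in> A\<rbrakk> \<Longrightarrow> app (K 0 [a]) c = eta T A a"
  using app_realizer[of "Var 0" "[a]" c] by (simp add: numeral_2_eq_2)

lemma app_K_Suc: "\<lbrakk>a \<in> A; c \<in> A\<rbrakk> \<Longrightarrow> app (K (Suc n) [a]) c = eta T A (K n [a])"
  using app_realizer[of "App (Code (K n [])) (Var 0)" "[a]" c]
  by (simp add: numeral_2_eq_2 K_closed mlet_eta_left' app_closed mlet_closed carrier_obj
      eta_closed app_K_Nil)

lemma app_S_0:
  assumes "u \<in> A" "v \<in> A" "c \<in> A"
  shows "app (S 0 [u, v]) c = mlet T A A (app u c) (\<lambda>f. mlet T A A (app v c) (\<lambda>a. app f a))"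
  using app_realizer[of "App (App (Var 0) (Var 2)) (App (Var 1) (Var 2))" "[u, v]" c] assms
  by (simp add: numeral_3_eq_3 mlet_eta_left' app_closed mlet_closed carrier_obj eta_closed)

text \<open>Two arguments fall short of the arity three, so the partial application clause of
  computability makes the result pure.\<close>

lemma mlet_app_S:
  assumes "u \<in> A" "v \<in> A"
  shows "mlet T A A (app (S n []) u) (\<lambda>f. app f v) = eta T A (S n [u, v])"
proof -
  have "iter_app T A app (S n []) [u, v] = eta T A (S n [u, v])"
    using assms by (cases n) (auto intro!: iter_app_realizer_partial S_closed simp del: iter_app.simps)
  moreover have "mlet T A A (app (S n []) u) (\<lambda>b. iter_app T A app b [v]) =
      mlet T A A (app (S n []) u) (\<lambda>f. app f v)"
    using assms by (intro mlet_cong iter_app_single)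
  ultimately show ?thesis
    by simp
qed

lemma app_S_Suc:
  assumes "u \<in> A" "v \<in> A" "c \<in> A" "u' \<in> A" "v' \<in> A"
    and "app u c = eta T A u'" "app v c = eta T A v'"
  shows "app (S (Suc n) [u, v]) c = eta T A (S n [u', v'])"
proof -
  have "app (S (Suc n) [u, v]) c =
      mlet T A A (app (S n []) u') (\<lambda>f. mlet T A A (eta T A v') (app f))"
    using app_realizer[of "App (App (Code (S n [])) (App (Var 0) (Var 2))) (App (Var 1) (Var 2))"
        "[u, v]" c] assms
    by (simp add: numeral_3_eq_3 S_closed mlet_eta_left' app_closed mlet_closed carrier_obj
        eta_closed)
  \<comment> \<open>The left unit law under the binder needs \<open>f\<close> in \<open>A\<close>,
    which \<open>mlet_cong\<close> supplies.\<close>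
  also have "\<dots> = mlet T A A (app (S n []) u') (\<lambda>f. app f v')"
    using assms by (intro mlet_cong) (simp add: mlet_eta_left' app_closed)
  also have "\<dots> = eta T A (S n [u', v'])"
    using assms by (simp add: mlet_app_S)
  finally show ?thesis .
qed

lemma app_proj_0: "c \<in> A \<Longrightarrow> app (proj 0 i) c = eta T A c"
  using app_realizer[of "Var 0" "[]" c] by simp

lemma app_proj_Suc_0: "c \<in> A \<Longrightarrow> app (proj (Suc n) 0) c = eta T A (K n [c])"
  using app_realizer[of "App (Code (K n [])) (Var 0)" "[]" c]
  by (simp add: K_closed mlet_eta_left' app_closed mlet_closed carrier_obj eta_closed app_K_Nil)

lemma app_proj_Suc_Suc: "c \<in> A \<Longrightarrow> app (proj (Suc n) (Suc i)) c = eta T A (proj n i)"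
  using app_realizer[of "Code (proj n i)" "[]" c] by (simp add: proj_closed)

text \<open>For \<open>App\<close>, the induction hypotheses give the pure values that
  \<open>app_S_Suc\<close> requires.\<close>

lemma app_lambda_Suc:
  "\<lbrakk>e \<in> exprs (Suc (Suc n)) A; c \<in> A\<rbrakk> \<Longrightarrow> app (lambda (Suc n) e) c = eta T A (lambda n (subst e c))"
proof (induction e)
  case (Var i)
  then show ?case
    by (cases i) (simp_all add: app_proj_Suc_0 app_proj_Suc_Suc del: proj.simps)
next
  case (Code a)
  then show ?case
    by (simp add: app_K_Suc del: K.simps)
next
  case (App e1 e2)
  then have "lambda n (subst e1 c) \<in> A" "lambda n (subst e2 c) \<in> A"
    by (auto intro: lambda_closed subst_in_exprs)
  with App show ?case
    by (auto intro!: app_S_Suc lambda_closed simp del: S.simps)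
qed

text \<open>\<open>S 0\<close> runs operator before operand, as \<open>eval_expr\<close> does, so
  the effects agree.\<close>

lemma app_lambda_0:
  "\<lbrakk>e \<in> exprs (Suc 0) A; c \<in> A\<rbrakk> \<Longrightarrow> app (lambda 0 e) c = eval_expr T A app (subst e c)"
proof (induction e)
  case (App e1 e2)
  then show ?case
    by (simp add: app_S_0 lambda_closed[where m = "Suc 0"] del: S.simps)
qed (simp_all add: app_proj_0 app_K_0 del: proj.simps K.simps)

lemma mca_lambda: "mca \<U> T A app lambda"
  by unfold_locales (simp_all add: lambda_closed app_lambda_Suc app_lambda_0)

end

theorem theorem1:
  fixes \<U> :: "'u set set" and T :: "'u monad_data"
    and A :: "'u set" and app :: "'u \<Rightarrow> 'u \<Rightarrow> 'u"
  assumes "set_monad \<U> T" and "mas \<U> T A app"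
  shows "(\<exists>lam. mca \<U> T A app lam) \<longleftrightarrow> combinatory_object \<U> T A app"
  using mca.combinatory_object combinatory_object.mca_lambda by blast

end
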